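(* Let $T$ be a Leibniz triple system with universal Leibniz envelope $U(T)$, let $\theta$ be the involutive automorphism of $U(T)$ determining $T$, and let $V$ be a $\theta$-invariant subspace of $U(T)$. If $V$ is an ideal of $U(T)$, then $V\cap T$ is an ideal of $T$ and $V\cap (T\otimes T)$ is an ideal of $T\otimes T$ such that $$i(V\cap T)\subseteq V\cap (T\otimes T)\subseteq j(V\cap T),\qquad \mathcal{I}(V\cap T)\subseteq V\subseteq \mathcal{J}(V\cap T).$$
   Context: All vector spaces are finite-dimensional over a fixed field $\mathbb{K}$ of characteristic $0$. Products of subspaces denote linear spans. A Leibniz triple system is a vector space $T$ with a trilinear operation $\{\cdot,\cdot,\cdot\}:T\times T\times T\to T$ satisfying, for all $a,b,c,d,e\in T$, $\{a\{bcd\}e\}=\{\{abc\}de\}-\{\{acb\}de\}-\{\{adb\}ce\}+\{\{adc\}be\}$ and $\{ab\{cde\}\}=\{\{abc\}de\}-\{\{abd\}ce\}-\{\{abe\}cd\}+\{\{abe\}dc\}$. An ideal of $T$ is a subspace $I$ with $\{ITT\}+\{TIT\}+\{TTI\}\subseteq I$. The universal Leibniz envelope of $T$ is the Leibniz algebra (bilinear bracket with $[[x,y],z]=[[x,z],y]+[x,[y,z]]$) $U(T)=T\oplus(T\otimes T)$ with bracket $[a,b]=a\otimes b$, $[a\otimes b,c]=\{abc\}$, $[a,b\otimes c]=\{abc\}-\{acb\}$, $[a\otimes b,c\otimes d]=\{abc\}\otimes d-\{abd\}\otimes c$. $T$ is identified with the first summand, and $T\otimes T$ is a subalgebra of $U(T)$.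 Ideals of Leibniz algebras are two-sided. The involutive automorphism of $U(T)$ determining $T$ is $\theta(a+\sum b\otimes c)=-a+\sum b\otimes c$. For an ideal $I$ of $T$: $i(I)=I\otimes T+T\otimes I$; $j(I)=\{w\in T\otimes T\mid [w,T]+[T,w]\subseteq I\}$; $\mathcal{I}(I)=I+i(I)$; $\mathcal{J}(I)=I+j(I)$. *)

theory Defs
  imports "HOL-Analysis.Product_Vector" "HOL-Library.Set_Algebras"
begin

definition bilinear_map ::
  "('k::field \<Rightarrow> 'a::ab_group_add \<Rightarrow> 'a) \<Rightarrow> ('k \<Rightarrow> 'b::ab_group_add \<Rightarrow> 'b) \<Rightarrow>
   ('k \<Rightarrow> 'c::ab_group_add \<Rightarrow> 'c) \<Rightarrow> ('a \<Rightarrow> 'b \<Rightarrow> 'c) \<Rightarrow> bool" where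
  "bilinear_map s1 s2 s3 f \<longleftrightarrow>
     (\<forall>x. Vector_Spaces.linear s2 s3 (\<lambda>y. f x y)) \<and>
     (\<forall>y. Vector_Spaces.linear s1 s3 (\<lambda>x. f x y))"

definition trilinear_map ::
  "('k::field \<Rightarrow> 'a::ab_group_add \<Rightarrow> 'a) \<Rightarrow> ('a \<Rightarrow> 'a \<Rightarrow> 'a \<Rightarrow> 'a) \<Rightarrow> bool" where
  "trilinear_map s t \<longleftrightarrow>
     (\<forall>b c. Vector_Spaces.linear s s (\<lambda>a. t a b c)) \<and>
     (\<forall>a c. Vector_Spaces.linear s s (\<lambda>b. t a b c)) \<and>
     (\<forall>a b. Vector_Spaces.linear s s (\<lambda>c. t a b c))"


section \<open>Leibniz triple systems and ideals\<close>

locale leibniz_triple_system = vector_space scale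
  for scale :: "'k::field_char_0 \<Rightarrow> 'a::ab_group_add \<Rightarrow> 'a" +
  fixes trip :: "'a \<Rightarrow> 'a \<Rightarrow> 'a \<Rightarrow> 'a"
  assumes finite_dim: "\<exists>B. finite B \<and> span B = UNIV"
    and trilinear: "trilinear_map scale trip"
    and lts1: "trip a (trip b c d) e =
      trip (trip a b c) d e - trip (trip a c b) d e - trip (trip a d b) c e + trip (trip a d c) b e"
    and lts2: "trip a b (trip c d e) =
      trip (trip a b c) d e - trip (trip a b d) c e - trip (trip a b e) c d + trip (trip a b e) d c"

definition triple_span ::
  "('k::field \<Rightarrow> 'a::ab_group_add \<Rightarrow> 'a) \<Rightarrow> ('a \<Rightarrow> 'a \<Rightarrow> 'a \<Rightarrow> 'a) \<Rightarrow>
   'a set \<Rightarrow> 'a set \<Rightarrow> 'a set \<Rightarrow> 'a set" where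
  "triple_span s t A B C = module.span s {t a b c | a b c. a \<in> A \<and> b \<in> B \<and> c \<in> C}"

definition lts_ideal ::
  "('k::field \<Rightarrow> 'a::ab_group_add \<Rightarrow> 'a) \<Rightarrow> ('a \<Rightarrow> 'a \<Rightarrow> 'a \<Rightarrow> 'a) \<Rightarrow> 'a set \<Rightarrow> bool" where
  "lts_ideal s t I \<longleftrightarrow> module.subspace s I \<and>
     triple_span s t I UNIV UNIV + triple_span s t UNIV I UNIV + triple_span s t UNIV UNIV I \<subseteq> I"

text \<open>\<^term>\<open>product_span\<close> is also used for the tensor product of two subspaces.\<close>

definition product_span ::
  "('k::field \<Rightarrow> 'c::ab_group_add \<Rightarrow> 'c) \<Rightarrow> ('a \<Rightarrow> 'b \<Rightarrow> 'c) \<Rightarrow> 'a set \<Rightarrow> 'b set \<Rightarrow> 'c set" where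
  "product_span s f A B = module.span s {f a b | a b. a \<in> A \<and> b \<in> B}"

text \<open>Two-sided ideals \<open>J\<close> of a subalgebra \<open>A\<close> with respect to the bracket \<open>br\<close>; \<open>A = UNIV\<close> gives
  the ideals of the whole algebra.\<close>

definition two_sided_ideal ::
  "('k::field \<Rightarrow> 'u::ab_group_add \<Rightarrow> 'u) \<Rightarrow> ('u \<Rightarrow> 'u \<Rightarrow> 'u) \<Rightarrow> 'u set \<Rightarrow> 'u set \<Rightarrow> bool" where
  "two_sided_ideal s br A J \<longleftrightarrow> module.subspace s J \<and> J \<subseteq> A \<and>
     product_span s br J A + product_span s br A J \<subseteq> J"


section \<open>Tensor products\<close>

text \<open>\<open>sW\<close>, \<open>tens\<close> is a tensor product of \<open>s1\<close> and \<open>s2\<close>, given by its universal property.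
  A locale assumption cannot quantify over all target types, so the property is stated for bilinear
  forms only; \<open>universal_property\<close> below derives it for every target vector space, on any type.\<close>

locale tensor_product =
  T1: vector_space s1 + T2: vector_space s2 + W: vector_space sW
  for s1 :: "'k::field \<Rightarrow> 'a::ab_group_add \<Rightarrow> 'a"
    and s2 :: "'k \<Rightarrow> 'b::ab_group_add \<Rightarrow> 'b"
    and sW :: "'k \<Rightarrow> 'w::ab_group_add \<Rightarrow> 'w" +
  fixes tens :: "'a \<Rightarrow> 'b \<Rightarrow> 'w"
  assumes bilinear_tens: "bilinear_map s1 s2 sW tens"
    and universal_forms: "bilinear_map s1 s2 (*) \<beta> \<Longrightarrow>
      \<exists>!\<phi>. Vector_Spaces.linear sW (*) \<phi> \<and> (\<forall>x y. \<phi> (tens x y) = \<beta> x y)"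

definition tensor_lift ::
  "('k::field \<Rightarrow> 'w::ab_group_add \<Rightarrow> 'w) \<Rightarrow> ('k \<Rightarrow> 'x::ab_group_add \<Rightarrow> 'x) \<Rightarrow> ('a \<Rightarrow> 'b \<Rightarrow> 'w) \<Rightarrow>
   ('a \<Rightarrow> 'b \<Rightarrow> 'x) \<Rightarrow> 'w \<Rightarrow> 'x" where
  "tensor_lift sW sX tens f =
     (THE \<phi>. Vector_Spaces.linear sW sX \<phi> \<and> (\<forall>x y. \<phi> (tens x y) = f x y))"

lemma vector_space_field: "vector_space ((*) :: 'k::field \<Rightarrow> 'k \<Rightarrow> 'k)"
  by unfold_locales (auto simp: algebra_simps)

lemma exists_separating_functional:
  fixes s :: "'k::field \<Rightarrow> 'a::ab_group_add \<Rightarrow> 'a"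
  assumes "vector_space s" "v \<notin> module.span s S"
  shows "\<exists>\<phi>. Vector_Spaces.linear s (*) \<phi> \<and> (\<forall>x\<in>S. \<phi> x = 0) \<and> \<phi> v = 1"
proof -
  interpret vector_space s by fact
  interpret K: vector_space "(*) :: 'k \<Rightarrow> 'k \<Rightarrow> 'k" by (rule vector_space_field)
  interpret P: vector_space_pair s "(*) :: 'k \<Rightarrow> 'k \<Rightarrow> 'k" ..
  obtain B where B: "B \<subseteq> S" "independent B" "S \<subseteq> span B"
    using maximal_independent_subset[of S] by metis
  have "v \<notin> span B" using assms(2) span_mono[OF B(1)] by auto
  then have ind: "independent (insert v B)" and "v \<notin> B"
    using B(2) independent_insertI span_base by blast+
  define \<phi> where "\<phi> = P.construct (insert v B) (\<lambda>b. if b = v then 1 else 0)"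
  have lin: "Vector_Spaces.linear s (*) \<phi>"
    unfolding \<phi>_def by (rule P.linear_construct[OF ind])
  have 1: "\<phi> v = 1" unfolding \<phi>_def by (subst P.construct_basis[OF ind]) auto
  have 0: "\<phi> b = 0" if "b \<in> B" for b
    unfolding \<phi>_def using that \<open>v \<notin> B\<close> by (subst P.construct_basis[OF ind]) auto
  have "\<phi> x = 0" if "x \<in> S" for x
    using P.linear_eq_0_on_span[OF lin, of B x] 0 B(3) that by blast
  with lin 1 show ?thesis by blast
qed

lemma bilinear_map_compose:
  assumes "bilinear_map s1 s2 sX f" "Vector_Spaces.linear sX sY \<psi>"
  shows "bilinear_map s1 s2 sY (\<lambda>x y. \<psi> (f x y))"
  unfolding bilinear_map_def
proof (intro conjI allI)
  fix x
  have "Vector_Spaces.linear s2 sX (f x)" using assms(1) by (auto simp: bilinear_map_def)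
  from Vector_Spaces.linear_compose[OF this assms(2)] show "Vector_Spaces.linear s2 sY (\<lambda>y. \<psi> (f x y))"
    by (simp add: comp_def)
next
  fix y
  have "Vector_Spaces.linear s1 sX (\<lambda>x. f x y)" using assms(1) by (auto simp: bilinear_map_def)
  from Vector_Spaces.linear_compose[OF this assms(2)] show "Vector_Spaces.linear s1 sY (\<lambda>x. \<psi> (f x y))"
    by (simp add: comp_def)
qed

context tensor_product
begin

lemma span_pure: "W.span {tens x y | x y. True} = UNIV"
proof (rule ccontr)
  assume "\<not> ?thesis"
  then obtain v where "v \<notin> W.span {tens x y | x y. True}" by auto
  from exists_separating_functional[OF W.vector_space_axioms this]
  obtain \<phi> where \<phi>: "Vector_Spaces.linear sW (*) \<phi>" "\<And>x y. \<phi> (tens x y) = 0" "\<phi> v = 1" by auto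
  interpret K: vector_space "(*) :: 'k \<Rightarrow> 'k \<Rightarrow> 'k" by (rule vector_space_field)
  interpret P: vector_space_pair sW "(*) :: 'k \<Rightarrow> 'k \<Rightarrow> 'k" ..
  interpret P1: vector_space_pair s1 "(*) :: 'k \<Rightarrow> 'k \<Rightarrow> 'k" ..
  interpret P2: vector_space_pair s2 "(*) :: 'k \<Rightarrow> 'k \<Rightarrow> 'k" ..
  have "bilinear_map s1 s2 (*) (\<lambda>x y. 0::'k)"
    unfolding bilinear_map_def using P1.linear_zero P2.linear_zero by blast
  from universal_forms[OF this] \<phi> P.linear_zero have "\<phi> = (\<lambda>_. 0)" by blast
  with \<phi>(3) show False by simp
qed

lemma linear_eq_pure:
  assumes "Vector_Spaces.linear sW sX f" "Vector_Spaces.linear sW sX g"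
    "\<And>x y. f (tens x y) = g (tens x y)"
  shows "f = g"
proof -
  interpret f: Vector_Spaces.linear sW sX f by fact
  interpret P: vector_space_pair sW sX ..
  show ?thesis
    using P.linear_eq_on[OF assms(1,2)] span_pure assms(3) by blast
qed

theorem universal_property:
  fixes sX :: "'k \<Rightarrow> 'x::ab_group_add \<Rightarrow> 'x"
  assumes X: "vector_space sX" and f: "bilinear_map s1 s2 sX f"
  shows "\<exists>!\<phi>. Vector_Spaces.linear sW sX \<phi> \<and> (\<forall>x y. \<phi> (tens x y) = f x y)"
proof -
  interpret X: vector_space sX by fact
  interpret P: vector_space_prod sW sX ..
  define G where "G = P.p.span {(tens x y, f x y) | x y. True}"
  have G_sub: "P.p.subspace G" unfolding G_def by simp
  have uniq: "z = 0" if "(0, z) \<in> G" for z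
  proof (rule ccontr)
    assume "z \<noteq> 0"
    then obtain \<psi> where \<psi>: "Vector_Spaces.linear sX (*) \<psi>" "\<psi> z = 1"
      using exists_separating_functional[OF X, of z "{}"] by auto
    obtain \<phi> where \<phi>: "Vector_Spaces.linear sW (*) \<phi>" "\<And>x y. \<phi> (tens x y) = \<psi> (f x y)"
      using universal_forms[OF bilinear_map_compose[OF f \<psi>(1)]] by blast
    interpret \<phi>: Vector_Spaces.linear sW "(*)" \<phi> by fact
    interpret \<psi>: Vector_Spaces.linear sX "(*)" \<psi> by fact
    have "P.p.subspace {p. \<phi> (fst p) = \<psi> (snd p)}"
      unfolding P.p.subspace_def
      by (auto simp: \<phi>.zero \<psi>.zero \<phi>.add \<psi>.add \<phi>.scale \<psi>.scale P.scale_def)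
    then have "G \<subseteq> {p. \<phi> (fst p) = \<psi> (snd p)}"
      unfolding G_def using \<phi>(2) by (intro P.p.span_minimal) auto
    with that have "\<phi> 0 = \<psi> z" by auto
    with \<psi>(2) show False by (simp add: \<phi>.zero)
  qed
  have uniq': "z = z'" if "(w, z) \<in> G" "(w, z') \<in> G" for w z z'
    using P.p.subspace_diff[OF G_sub that] uniq[of "z - z'"] by simp
  have ex: "\<exists>z. (w, z) \<in> G" for w
  proof -
    have "W.subspace {w. \<exists>z. (w, z) \<in> G}"
      unfolding W.subspace_def
      using P.p.subspace_0[OF G_sub] P.p.subspace_add[OF G_sub] P.p.subspace_scale[OF G_sub]
      by (fastforce simp: zero_prod_def P.scale_def)
    then have "W.span {tens x y | x y. True} \<subseteq> {w. \<exists>z. (w, z) \<in> G}"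
      unfolding G_def by (intro W.span_minimal) (blast intro: P.p.span_base)+
    then show ?thesis using span_pure by auto
  qed
  define \<phi> where "\<phi> w = (THE z. (w, z) \<in> G)" for w
  have \<phi>_eq: "\<phi> w = z \<longleftrightarrow> (w, z) \<in> G" for w z
    unfolding \<phi>_def using ex[of w] uniq'[of w] by (metis the_equality)
  have pure: "\<phi> (tens x y) = f x y" for x y
    unfolding \<phi>_eq G_def by (rule P.p.span_base) auto
  have "Vector_Spaces.linear sW sX \<phi>"
  proof unfold_locales
    show "\<phi> (a + b) = \<phi> a + \<phi> b" for a b
      using P.p.subspace_add[OF G_sub, of "(a, \<phi> a)" "(b, \<phi> b)"] \<phi>_eq by auto
    show "\<phi> (sW c a) = sX c (\<phi> a)" for c a
      using P.p.subspace_scale[OF G_sub, of "(a, \<phi> a)" c] \<phi>_eq by (auto simp: P.scale_def)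
  qed
  with pure show ?thesis using linear_eq_pure by (metis (no_types, lifting))
qed

lemma
  assumes "vector_space sX" "bilinear_map s1 s2 sX f"
  shows linear_tensor_lift: "Vector_Spaces.linear sW sX (tensor_lift sW sX tens f)"
    and tensor_lift_pure: "tensor_lift sW sX tens f (tens x y) = f x y"
  using theI'[OF universal_property[OF assms]] unfolding tensor_lift_def by auto

end


section \<open>The universal Leibniz envelope\<close>

text \<open>\<open>U(T)\<close> lives on the product type \<^typ>\<open>'a \<times> 'w\<close>, where \<open>'a\<close> carries \<open>T\<close> and \<open>'w\<close> carries
  \<open>T \<otimes> T\<close>.  Here \<open>T \<otimes> T\<close> is the full tensor product, with no relations imposed.  The bracket below
  then need not satisfy the Leibniz identity: for \<open>T = sl\<^sub>2\<close> with \<open>{abc} = [[a, b], c]\<close> it fails for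
  \<open>a, a, c \<otimes> d\<close> whenever \<open>x = [a, [c, d]] \<noteq> 0\<close>, as it would give \<open>x \<otimes> a + a \<otimes> x = 0\<close>.
  No Leibniz identity for \<open>U(T)\<close> is therefore assumed; the notion of ideal does not involve it.\<close>

definition in_T :: "'a \<Rightarrow> 'a \<times> 'w::zero" where "in_T a = (a, 0)"

definition in_TT :: "'w \<Rightarrow> 'a::zero \<times> 'w" where "in_TT w = (0, w)"

abbreviation T_part :: "('a::zero \<times> 'w::zero) set" where "T_part \<equiv> range in_T"

abbreviation TT_part :: "('a::zero \<times> 'w::zero) set" where "TT_part \<equiv> range in_TT"

abbreviation ule_scale ::
  "('k::field \<Rightarrow> 'a::ab_group_add \<Rightarrow> 'a) \<Rightarrow> ('k \<Rightarrow> 'w::ab_group_add \<Rightarrow> 'w) \<Rightarrow>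
   'k \<Rightarrow> 'a \<times> 'w \<Rightarrow> 'a \<times> 'w" where
  "ule_scale \<equiv> module_prod.scale"

text \<open>The bilinear extension of
  \<open>[a, b] = a \<otimes> b\<close>, \<open>[a \<otimes> b, c] = {abc}\<close>, \<open>[a, b \<otimes> c] = {abc} - {acb}\<close> and
  \<open>[a \<otimes> b, c \<otimes> d] = {abc} \<otimes> d - {abd} \<otimes> c\<close>.\<close>

definition ule_bracket ::
  "('k::field \<Rightarrow> 'a::ab_group_add \<Rightarrow> 'a) \<Rightarrow> ('k \<Rightarrow> 'w::ab_group_add \<Rightarrow> 'w) \<Rightarrow>
   ('a \<Rightarrow> 'a \<Rightarrow> 'a \<Rightarrow> 'a) \<Rightarrow> ('a \<Rightarrow> 'a \<Rightarrow> 'w) \<Rightarrow> 'a \<times> 'w \<Rightarrow> 'a \<times> 'w \<Rightarrow> 'a \<times> 'w" where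
  "ule_bracket s sW trip tens p q =
     (tensor_lift sW s tens (\<lambda>a b. trip a b (fst q)) (snd p) +
      tensor_lift sW s tens (\<lambda>b c. trip (fst p) b c - trip (fst p) c b) (snd q),
      tens (fst p) (fst q) +
      tensor_lift sW sW tens
        (\<lambda>a b. tensor_lift sW sW tens (\<lambda>c d. tens (trip a b c) d - tens (trip a b d) c) (snd q))
        (snd p))"

definition ule_theta :: "'a::ab_group_add \<times> 'w \<Rightarrow> 'a \<times> 'w" where
  "ule_theta p = (- fst p, snd p)"

text \<open>For a subspace \<open>I\<close> of \<open>T\<close>, the following four are subsets of \<open>U(T)\<close>.\<close>

definition ule_i ::
  "('k::field \<Rightarrow> 'w::ab_group_add \<Rightarrow> 'w) \<Rightarrow> ('a::ab_group_add \<Rightarrow> 'a \<Rightarrow> 'w) \<Rightarrow>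
   'a set \<Rightarrow> ('a \<times> 'w) set" where
  "ule_i sW tens I = in_TT ` (product_span sW tens I UNIV + product_span sW tens UNIV I)"

definition ule_j ::
  "('k::field \<Rightarrow> 'a::ab_group_add \<Rightarrow> 'a) \<Rightarrow> ('k \<Rightarrow> 'w::ab_group_add \<Rightarrow> 'w) \<Rightarrow>
   ('a \<Rightarrow> 'a \<Rightarrow> 'a \<Rightarrow> 'a) \<Rightarrow> ('a \<Rightarrow> 'a \<Rightarrow> 'w) \<Rightarrow> 'a set \<Rightarrow> ('a \<times> 'w) set" where
  "ule_j s sW trip tens I =
     {w \<in> TT_part.
        product_span (ule_scale s sW) (ule_bracket s sW trip tens) {w} T_part +
        product_span (ule_scale s sW) (ule_bracket s sW trip tens) T_part {w} \<subseteq> in_T ` I}"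

definition ule_I ::
  "('k::field \<Rightarrow> 'w::ab_group_add \<Rightarrow> 'w) \<Rightarrow> ('a::ab_group_add \<Rightarrow> 'a \<Rightarrow> 'w) \<Rightarrow>
   'a set \<Rightarrow> ('a \<times> 'w) set" where
  "ule_I sW tens I = in_T ` I + ule_i sW tens I"

definition ule_J ::
  "('k::field \<Rightarrow> 'a::ab_group_add \<Rightarrow> 'a) \<Rightarrow> ('k \<Rightarrow> 'w::ab_group_add \<Rightarrow> 'w) \<Rightarrow>
   ('a \<Rightarrow> 'a \<Rightarrow> 'a \<Rightarrow> 'a) \<Rightarrow> ('a \<Rightarrow> 'a \<Rightarrow> 'w) \<Rightarrow> 'a set \<Rightarrow> ('a \<times> 'w) set" where
  "ule_J s sW trip tens I = in_T ` I + ule_j s sW trip tens I"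

text \<open>\<open>ule_bracket\<close> is bilinear and has the stated values on generators, and \<open>ule_theta\<close> is an
  involutive automorphism for it.\<close>

locale leibniz_envelope =
  leibniz_triple_system scale trip + TP: tensor_product scale scale tscale tens
  for scale :: "'k::field_char_0 \<Rightarrow> 'a::ab_group_add \<Rightarrow> 'a"
    and trip :: "'a \<Rightarrow> 'a \<Rightarrow> 'a \<Rightarrow> 'a"
    and tscale :: "'k \<Rightarrow> 'w::ab_group_add \<Rightarrow> 'w"
    and tens :: "'a \<Rightarrow> 'a \<Rightarrow> 'w"
begin

sublocale vector_space_prod scale tscale ..
sublocale TT: vector_space_pair scale scale ..
sublocale TW: vector_space_pair scale tscale ..
sublocale WT: vector_space_pair tscale scale ..
sublocale WW: vector_space_pair tscale tscale ..

abbreviation "br \<equiv> ule_bracket scale tscale trip tens"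
abbreviation "us \<equiv> ule_scale scale tscale"

lemma trip_linear:
  "trip (a + a') b c = trip a b c + trip a' b c"
  "trip a (b + b') c = trip a b c + trip a b' c"
  "trip a b (c + c') = trip a b c + trip a b c'"
  "trip (scale k a) b c = scale k (trip a b c)"
  "trip a (scale k b) c = scale k (trip a b c)"
  "trip a b (scale k c) = scale k (trip a b c)"
  using trilinear unfolding trilinear_map_def Vector_Spaces.linear_iff by blast+

lemma tens_linear:
  "tens (a + a') b = tens a b + tens a' b"
  "tens a (b + b') = tens a b + tens a b'"
  "tens (scale k a) b = tscale k (tens a b)"
  "tens a (scale k b) = tscale k (tens a b)"
  using TP.bilinear_tens unfolding bilinear_map_def Vector_Spaces.linear_iff by blast+

lemma trip_0 [simp]: "trip 0 b c = 0" "trip a 0 c = 0" "trip a b 0 = 0"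
  using trip_linear(4)[of 0] trip_linear(5)[of _ 0] trip_linear(6)[of _ _ 0] by auto

lemma tens_0 [simp]: "tens 0 b = 0" "tens a 0 = 0"
  using tens_linear(3)[of 0] tens_linear(4)[of _ 0] by auto

lemma bil_T: "bilinear_map scale scale scale f \<longleftrightarrow>
    (\<forall>a a' b. f (a + a') b = f a b + f a' b) \<and> (\<forall>a b b'. f a (b + b') = f a b + f a b') \<and>
    (\<forall>k a b. f (scale k a) b = scale k (f a b)) \<and> (\<forall>k a b. f a (scale k b) = scale k (f a b))"
  unfolding bilinear_map_def Vector_Spaces.linear_iff using TT.vector_space_pair_axioms vector_space_axioms
  by auto

lemma bil_W: "bilinear_map scale scale tscale f \<longleftrightarrow>
    (\<forall>a a' b. f (a + a') b = f a b + f a' b) \<and> (\<forall>a b b'. f a (b + b') = f a b + f a b') \<and>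
    (\<forall>k a b. f (scale k a) b = tscale k (f a b)) \<and> (\<forall>k a b. f a (scale k b) = tscale k (f a b))"
  unfolding bilinear_map_def Vector_Spaces.linear_iff using vector_space_axioms TP.W.vector_space_axioms
  by auto

lemmas arith = trip_linear tens_linear scale_right_distrib
  TP.W.scale_right_distrib scale_right_diff_distrib TP.W.scale_right_diff_distrib

lemma bil1: "bilinear_map scale scale scale (\<lambda>a b. trip a b c)"
  by (simp add: bil_T arith)

lemma bil2: "bilinear_map scale scale scale (\<lambda>b c. trip a b c - trip a c b)"
  by (simp add: bil_T arith)

lemma bil3: "bilinear_map scale scale tscale (\<lambda>c d. tens (trip a b c) d - tens (trip a b d) c)"
  by (simp add: bil_W arith)

definition "L1 c = tensor_lift tscale scale tens (\<lambda>a b. trip a b c)"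
definition "L2 a = tensor_lift tscale scale tens (\<lambda>b c. trip a b c - trip a c b)"
definition "L3 a b =
  tensor_lift tscale tscale tens (\<lambda>c d. tens (trip a b c) d - tens (trip a b d) c)"
definition "L4 v = tensor_lift tscale tscale tens (\<lambda>a b. L3 a b v)"

lemma ule_bracket_Pair:
  "br (a, u) (b, v) = (L1 b u + L2 a v, tens a b + L4 v u)"
  by (simp add: ule_bracket_def L1_def L2_def L3_def L4_def)

lemmas lin1 = TP.linear_tensor_lift[OF vector_space_axioms bil1, folded L1_def]
lemmas lin2 = TP.linear_tensor_lift[OF vector_space_axioms bil2, folded L2_def]
lemmas lin3 = TP.linear_tensor_lift[OF TP.W.vector_space_axioms bil3, folded L3_def]

lemmas pure123 = TP.tensor_lift_pure[OF vector_space_axioms bil1, folded L1_def]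
  TP.tensor_lift_pure[OF vector_space_axioms bil2, folded L2_def]
  TP.tensor_lift_pure[OF TP.W.vector_space_axioms bil3, folded L3_def]

lemma L3_param:
  "L3 (a + a') b = (\<lambda>v. L3 a b v + L3 a' b v)"
  "L3 a (b + b') = (\<lambda>v. L3 a b v + L3 a b' v)"
  "L3 (scale k a) b = (\<lambda>v. tscale k (L3 a b v))"
  "L3 a (scale k b) = (\<lambda>v. tscale k (L3 a b v))"
  by (intro TP.linear_eq_pure[where sX = tscale] WW.linear_compose_add
      WW.linear_compose_scale_right lin3; simp add: pure123 arith)+

lemma L3_bil: "bilinear_map scale scale tscale (\<lambda>a b. L3 a b v)"
  unfolding bil_W by (simp add: L3_param)

lemmas lin4 = TP.linear_tensor_lift[OF TP.W.vector_space_axioms L3_bil, folded L4_def]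
lemmas pure4 = TP.tensor_lift_pure[OF TP.W.vector_space_axioms L3_bil, folded L4_def]

lemmas lift_add = WT.linear_add[OF lin1] WT.linear_add[OF lin2] WW.linear_add[OF lin3]
  WW.linear_add[OF lin4]
lemmas lift_scale = WT.linear_scale[OF lin1] WT.linear_scale[OF lin2] WW.linear_scale[OF lin3]
  WW.linear_scale[OF lin4]
lemmas lift_0 = WT.linear_0[OF lin1] WT.linear_0[OF lin2] WW.linear_0[OF lin3]
  WW.linear_0[OF lin4]

lemma L1_param:
  "L1 (c + c') = (\<lambda>u. L1 c u + L1 c' u)" "L1 (scale k c) = (\<lambda>u. scale k (L1 c u))"
  by (intro TP.linear_eq_pure[where sX = scale] WT.linear_compose_add
      WT.linear_compose_scale_right lin1; simp add: pure123 arith)+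

lemma L2_param:
  "L2 (c + c') = (\<lambda>u. L2 c u + L2 c' u)" "L2 (scale k c) = (\<lambda>u. scale k (L2 c u))"
  by (intro TP.linear_eq_pure[where sX = scale] WT.linear_compose_add
      WT.linear_compose_scale_right lin2; simp add: pure123 arith)+

lemma L4_param:
  "L4 (v + v') = (\<lambda>u. L4 v u + L4 v' u)" "L4 (tscale k v) = (\<lambda>u. tscale k (L4 v u))"
  by (intro TP.linear_eq_pure[where sX = tscale] WW.linear_compose_add
      WW.linear_compose_scale_right lin4; simp add: pure4 lift_add lift_scale)+

lemmas lift_param = L1_param L2_param L4_param

lemma ule_bracket_linear:
  "br (p + p') q = br p q + br p' q" "br p (q + q') = br p q + br p q'"
  "br (us k p) q = us k (br p q)" "br p (us k q) = us k (br p q)"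
  by (cases p; cases p'; cases q; cases q';
    simp add: ule_bracket_Pair scale_prod arith lift_add lift_scale lift_param ac_simps)+

lemma ule_bracket_bilinear: "bilinear_map us us us br"
  unfolding bilinear_map_def Vector_Spaces.linear_iff
  using p.vector_space_axioms ule_bracket_linear by blast

lemma lift_zero_param [simp]: "L1 0 u = 0" "L2 0 u = 0" "L4 0 u = 0"
  using L1_param(2)[of 0 0] L2_param(2)[of 0 0] L4_param(2)[of 0 0]
  by (auto simp: fun_eq_iff)

theorem ule_bracket_values:
  "br (in_T a) (in_T b) = in_TT (tens a b)"
  "br (in_TT (tens a b)) (in_T c) = in_T (trip a b c)"
  "br (in_T a) (in_TT (tens b c)) = in_T (trip a b c - trip a c b)"
  "br (in_TT (tens a b)) (in_TT (tens c d)) =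
     in_TT (tens (trip a b c) d - tens (trip a b d) c)"
  by (simp_all add: ule_bracket_Pair in_T_def in_TT_def pure123 pure4 lift_0)

theorem ule_theta_automorphism:
  "Vector_Spaces.linear us us ule_theta" "ule_theta (ule_theta x) = x"
  "ule_theta (br x y) = br (ule_theta x) (ule_theta y)"
proof -
  show lin: "Vector_Spaces.linear us us ule_theta"
    unfolding Vector_Spaces.linear_iff using p.vector_space_axioms
    by (auto simp: ule_theta_def scale_prod split_paired_all)
  show "ule_theta (ule_theta x) = x" by (simp add: ule_theta_def)
  have *: "L2 (- a) v = - L2 a v" "tens (- a) (- b) = tens a b" "L1 (- b) u = - L1 b u" for a b u v
    using L2_param(2)[of "-1" a] L1_param(2)[of "-1" b] tens_linear(3)[of "-1" a "-b"]
      tens_linear(4)[of a "-1" b] by (auto simp: fun_eq_iff)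
  show "ule_theta (br x y) = br (ule_theta x) (ule_theta y)"
    by (cases x; cases y; simp add: ule_theta_def ule_bracket_Pair *)
qed

end

end

theory Submission
  imports Defs
begin

text \<open>The bracket of \<open>U(T) = T \<oplus> (T \<otimes> T)\<close> is graded modulo 2, with
  \<open>T\<close> odd and \<open>T \<otimes> T\<close> even, and it recovers both structures:
  \<open>a \<otimes> b = [a, b]\<close> and \<open>{abc} = [[a, b], c]\<close>. An ideal
  \<open>V\<close> absorbs brackets, so the first formula puts \<open>i(V \<inter> T)\<close> in
  \<open>V\<close> (\<open>ule_i_subset\<close>) and the second makes \<open>V \<inter> T\<close> an
  ideal of \<open>T\<close> (\<open>lts_ideal_T_part\<close>). The grading sends brackets of an even
  element of \<open>V\<close> with \<open>T\<close> into \<open>V \<inter> T\<close>, which is the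
  condition defining \<open>j\<close> (\<open>TT_part_subset_ule_j\<close>). The upper bound on
  \<open>V\<close> itself requires \<open>V\<close> to be the sum of its odd and even parts. These
  parts are the eigenspaces of \<theta> for -1 and 1, so \<theta>-invariance gives the splitting
  because 2 is invertible (\<open>subset_ule_J\<close>).\<close>

context leibniz_envelope
begin

lemma in_T_linear:
  "in_T (a + b) = (in_T a + in_T b :: 'a \<times> 'w)" "in_T (scale k a) = us k (in_T a)"
  "in_T 0 = (0 :: 'a \<times> 'w)"
  by (simp_all add: in_T_def scale_prod zero_prod_def)

lemma in_TT_linear:
  "in_TT (v + w) = (in_TT v + in_TT w :: 'a \<times> 'w)" "in_TT (tscale k v) = us k (in_TT v)"
  "in_TT 0 = (0 :: 'a \<times> 'w)"
  by (simp_all add: in_TT_def scale_prod zero_prod_def)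

text \<open>The set \<open>vimage in_T V\<close> stands for \<open>V \<inter> T\<close> moved back
  to the type carrying \<open>T\<close>, where \<open>lts_ideal\<close> and the arguments of
  \<open>ule_i\<close> and \<open>ule_j\<close> live.\<close>

lemma subspace_in_T_vimage: "p.subspace V \<Longrightarrow> subspace (in_T -` V)"
  unfolding subspace_def p.subspace_def by (simp add: in_T_linear)

lemma subspace_in_TT_vimage: "p.subspace V \<Longrightarrow> TP.W.subspace (in_TT -` V)"
  unfolding TP.W.subspace_def p.subspace_def by (simp add: in_TT_linear)

lemma subspace_T_part: "p.subspace T_part"
  unfolding p.subspace_def by (auto simp: in_T_def scale_prod zero_prod_def image_iff)

lemma subspace_TT_part: "p.subspace TT_part"
  unfolding p.subspace_def by (auto simp: in_TT_def scale_prod zero_prod_def image_iff)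

text \<open>Even with even is even, even with odd is odd: in the coordinate formula for
  \<open>br\<close>, the terms of the other parity contain a zero factor.\<close>

lemma bracket_in_parts:
  "x \<in> TT_part \<Longrightarrow> y \<in> TT_part \<Longrightarrow> br x y \<in> TT_part"
  "x \<in> TT_part \<Longrightarrow> y \<in> T_part \<Longrightarrow> br x y \<in> T_part"
  "x \<in> T_part \<Longrightarrow> y \<in> TT_part \<Longrightarrow> br x y \<in> T_part"
  by (auto simp: in_T_def in_TT_def ule_bracket_Pair lift_0 image_iff)

lemma set_plus_subset:
  "p.subspace V \<Longrightarrow> A \<subseteq> V \<Longrightarrow> B \<subseteq> V \<Longrightarrow> A + B \<subseteq> V"
  by (blast elim!: set_plus_elim intro: p.subspace_add)

lemma product_span_subset:
  assumes "p.subspace V" "\<And>x y. x \<in> A \<Longrightarrow> y \<in> B \<Longrightarrow> br x y \<in> V"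
  shows "product_span us br A B \<subseteq> V"
  unfolding product_span_def by (rule p.span_minimal) (use assms in auto)

lemma tensor_product_span_subset:
  assumes "TP.W.subspace W" "\<And>a b. a \<in> A \<Longrightarrow> b \<in> B \<Longrightarrow> tens a b \<in> W"
  shows "product_span tscale tens A B \<subseteq> W"
  unfolding product_span_def by (rule TP.W.span_minimal) (use assms in auto)

lemma triple_span_subset:
  assumes "subspace I" "\<And>a b c. a \<in> A \<Longrightarrow> b \<in> B \<Longrightarrow> c \<in> C \<Longrightarrow> trip a b c \<in> I"
  shows "triple_span scale trip A B C \<subseteq> I"
  unfolding triple_span_def by (rule span_minimal) (use assms in auto)

text \<open>Every bracket is a generator of one of the spans, and a subspace containing the
  generators contains the spans and their sum. This allows ideals to be handled element by
  element.\<close>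

lemma two_sided_ideal_iff:
  "two_sided_ideal us br A J \<longleftrightarrow> p.subspace J \<and> J \<subseteq> A \<and>
     (\<forall>x\<in>J. \<forall>y\<in>A. br x y \<in> J \<and> br y x \<in> J)"
proof (intro iffI conjI ballI)
  assume J: "two_sided_ideal us br A J"
  then show "p.subspace J" "J \<subseteq> A" by (auto simp: two_sided_ideal_def)
  fix x y assume xy: "x \<in> J" "y \<in> A"
  have sub: "product_span us br J A + product_span us br A J \<subseteq> J"
    using J by (simp add: two_sided_ideal_def)
  \<comment> \<open>The hypothesis bounds only the sum of the two spans; adding 0 from the other
    span embeds each of them in that sum.\<close>
  have 0: "0 \<in> product_span us br B C" for B C
    unfolding product_span_def by (rule p.span_zero)
  have "br x y \<in> product_span us br J A" "br y x \<in> product_span us br A J"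
    unfolding product_span_def by (rule p.span_base; use xy in blast)+
  then show "br x y \<in> J" "br y x \<in> J"
    using subsetD[OF sub set_plus_intro[of "br x y" _ 0]]
      subsetD[OF sub set_plus_intro[of 0 _ "br y x"]] 0 by auto
next
  assume J: "p.subspace J \<and> J \<subseteq> A \<and> (\<forall>x\<in>J. \<forall>y\<in>A. br x y \<in> J \<and> br y x \<in> J)"
  have "product_span us br J A \<subseteq> J" "product_span us br A J \<subseteq> J"
    using J by (auto intro!: product_span_subset del: subsetI)
  then have "product_span us br J A + product_span us br A J \<subseteq> J"
    using J by (intro set_plus_subset) simp_all
  with J show "two_sided_ideal us br A J"
    by (simp add: two_sided_ideal_def)
qed

context
  fixes V
  assumes V_ideal: "two_sided_ideal us br UNIV V"
begin

lemma ideal_closed: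
  "p.subspace V" "x \<in> V \<Longrightarrow> br x y \<in> V" "y \<in> V \<Longrightarrow> br x y \<in> V"
  using V_ideal unfolding two_sided_ideal_iff by blast+

text \<open>In \<open>[[a, b], c]\<close> an entry from \<open>V\<close> at any of the three
  positions forces the whole bracket into the two-sided ideal.\<close>

lemma lts_ideal_T_part: "lts_ideal scale trip (in_T -` V)"
proof -
  have sub: "subspace (in_T -` V)"
    by (rule subspace_in_T_vimage[OF ideal_closed(1)])
  have "trip a b c \<in> in_T -` V" if "in_T a \<in> V \<or> in_T b \<in> V \<or> in_T c \<in> V" for a b c
  proof -
    have "in_T (trip a b c) = br (br (in_T a) (in_T b)) (in_T c)"
      by (simp add: ule_bracket_values)
    with that show ?thesis by (auto intro: ideal_closed)
  qed
  then have "triple_span scale trip (in_T -` V) UNIV UNIV \<subseteq> in_T -` V"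
    "triple_span scale trip UNIV (in_T -` V) UNIV \<subseteq> in_T -` V"
    "triple_span scale trip UNIV UNIV (in_T -` V) \<subseteq> in_T -` V"
    by (rule triple_span_subset[OF sub]; blast)+
  then show ?thesis
    unfolding lts_ideal_def using sub
    by (blast elim!: set_plus_elim intro: subspace_add)
qed

text \<open>\<open>T \<otimes> T\<close> is closed under the bracket, and an ideal meets a
  subalgebra in an ideal of that subalgebra.\<close>

lemma two_sided_ideal_TT_part: "two_sided_ideal us br TT_part (V \<inter> TT_part)"
  unfolding two_sided_ideal_iff
  using p.subspace_inter[OF ideal_closed(1) subspace_TT_part] ideal_closed bracket_in_parts(1)
  by blast

text \<open>A pure tensor with a factor in \<open>V \<inter> T\<close> is the bracket of its
  factors, hence lies in \<open>V\<close>; linearity extends this to the spans.\<close>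

lemma ule_i_subset: "ule_i tscale tens (in_T -` V) \<subseteq> V \<inter> TT_part"
proof -
  have sub: "TP.W.subspace (in_TT -` V)"
    by (rule subspace_in_TT_vimage[OF ideal_closed(1)])
  have "product_span tscale tens (in_T -` V) UNIV \<subseteq> in_TT -` V"
    "product_span tscale tens UNIV (in_T -` V) \<subseteq> in_TT -` V"
    by (rule tensor_product_span_subset[OF sub];
      simp add: ule_bracket_values(1)[symmetric] ideal_closed)+
  then have "product_span tscale tens (in_T -` V) UNIV + product_span tscale tens UNIV (in_T -` V)
      \<subseteq> in_TT -` V"
    using sub by (blast elim!: set_plus_elim intro: TP.W.subspace_add)
  then show ?thesis unfolding ule_i_def by blast
qed

lemma TT_part_subset_ule_j: "V \<inter> TT_part \<subseteq> ule_j scale tscale trip tens (in_T -` V)"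
proof
  fix w assume w: "w \<in> V \<inter> TT_part"
  have sub: "p.subspace (V \<inter> T_part)"
    by (rule p.subspace_inter[OF ideal_closed(1) subspace_T_part])
  have "product_span us br {w} T_part \<subseteq> V \<inter> T_part"
    "product_span us br T_part {w} \<subseteq> V \<inter> T_part"
    by (rule product_span_subset[OF sub]; use w in
      \<open>simp only: Int_iff singleton_iff ideal_closed bracket_in_parts simp_thms\<close>)+
  then have "product_span us br {w} T_part + product_span us br T_part {w} \<subseteq> V \<inter> T_part"
    by (rule set_plus_subset[OF sub])
  \<comment> \<open>The right-hand side is the form in which \<open>ule_j\<close> states its
    bound.\<close>
  also have "V \<inter> T_part = in_T ` (in_T -` V)"
    by blast
  finally show "w \<in> ule_j scale tscale trip tens (in_T -` V)"
    using w by (simp add: ule_j_def)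
qed

lemma ule_I_subset: "ule_I tscale tens (in_T -` V) \<subseteq> V"
  unfolding ule_I_def using ule_i_subset by (intro set_plus_subset ideal_closed(1)) auto

text \<open>Since \<open>\<theta>\<close> is the identity on \<open>T \<otimes> T\<close> and \<open>-1\<close> on \<open>T\<close>, halving \<open>x + \<theta> x\<close> gives the
  \<open>T \<otimes> T\<close>-component of \<open>x\<close>, which therefore stays in \<open>V\<close>.\<close>

lemma subset_ule_J:
  assumes "ule_theta ` V \<subseteq> V"
  shows "V \<subseteq> ule_J scale tscale trip tens (in_T -` V)"
proof
  fix x assume x: "x \<in> V"
  obtain a w where aw: "x = (a, w)" by (cases x)
  have "x + ule_theta x = us 2 (in_TT w)"
    using TP.W.scale_left_distrib[of 1 1 w] by (simp add: aw ule_theta_def in_TT_def scale_prod)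
  then have "in_TT w = us (1/2) (x + ule_theta x)"
    by simp
  also have "\<dots> \<in> V"
    using assms x by (intro p.subspace_scale p.subspace_add ideal_closed(1)) auto
  finally have w: "in_TT w \<in> V" .
  have x_eq: "x = in_T a + in_TT w"
    by (simp add: aw in_T_def in_TT_def)
  have "in_T a = x - in_TT w"
    by (simp add: x_eq)
  with x w have "in_T a \<in> V"
    by (simp add: p.subspace_diff[OF ideal_closed(1)])
  with w show "x \<in> ule_J scale tscale trip tens (in_T -` V)"
    unfolding ule_J_def x_eq using TT_part_subset_ule_j by (intro set_plus_intro) auto
qed

end

end

theorem theorem3p4:
  fixes scale :: "'k::field_char_0 \<Rightarrow> 'a::ab_group_add \<Rightarrow> 'a"
    and tscale :: "'k \<Rightarrow> 'w::ab_group_add \<Rightarrow> 'w"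
    and trip :: "'a \<Rightarrow> 'a \<Rightarrow> 'a \<Rightarrow> 'a"
    and tens :: "'a \<Rightarrow> 'a \<Rightarrow> 'w"
    and V :: "('a \<times> 'w) set"
  assumes lts: "leibniz_triple_system scale trip"
    and tensor: "tensor_product scale scale tscale tens"
    and subspace: "module.subspace (ule_scale scale tscale) V"
    and theta_invariant: "ule_theta ` V \<subseteq> V"
    and ideal: "two_sided_ideal (ule_scale scale tscale) (ule_bracket scale tscale trip tens) UNIV V"
  shows "lts_ideal scale trip (in_T -` V) \<and>
         two_sided_ideal (ule_scale scale tscale) (ule_bracket scale tscale trip tens)
           TT_part (V \<inter> TT_part) \<and>
         ule_i tscale tens (in_T -` V) \<subseteq> V \<inter> TT_part \<and>
         V \<inter> TT_part \<subseteq> ule_j scale tscale trip tens (in_T -` V) \<and>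
         ule_I tscale tens (in_T -` V) \<subseteq> V \<and>
         V \<subseteq> ule_J scale tscale trip tens (in_T -` V)"
proof -
  \<comment> \<open>The envelope locale combines the triple system and the tensor product without
    further axioms.\<close>
  interpret leibniz_envelope scale trip tscale tens
    using lts tensor by (rule leibniz_envelope.intro)
  show ?thesis
    using lts_ideal_T_part[OF ideal] two_sided_ideal_TT_part[OF ideal] ule_i_subset[OF ideal]
      TT_part_subset_ule_j[OF ideal] ule_I_subset[OF ideal] subset_ule_J[OF ideal theta_invariant]
    by blast
qed

end
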